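(* Let $K$ be a totally ordered type of keys and $V$ a type of values with a distinguished term $default:V$. Let $\mathbf{BT}$ be the type of binary trees with nodes labelled by pairs in $K\times V$, and let $insert:K\times V\times\mathbf{BT}\to\mathbf{BT}$ and $search:K\times\mathbf{BT}\to V$ be the insertion and search functions. Then for all $x:K$, all $b:V$ and all $t:\mathbf{BT}$, $$search(x,insert(x,b,t))=b.$$
   Context: The order on $K$ is total, with case analysis available: for $x,k:K$ exactly one of $x<k$, $x>k$, $x=k$ holds and it can be decided which. $\mathbf{BT}$ is the W-type with constructors $e$ of arity zero (the empty tree) and, for each $k:K$ and $v:V$, $cons(k,v,\_,\_)$ of arity two; $cons(k,v,l,r)$ is the tree whose root has key $k$ with associated value $v$, left subtree $l$ and right subtree $r$. Formally $\mathbf{BT}=W_{x:A}B(x)$ with $A\equiv K\times V+\mathbf{1}$, $B( * )\equiv\mathbf{0}$ (the empty type) and $B(k,v)\equiv\mathbf{2}$ (the booleans). Arbitrary binary trees are allowed; no search-tree ordering condition is imposed. The function $insert$ is defined recursively by: - $insert(x,b,e)\equiv cons(x,b,e,e)$; - if $t\equiv cons(k,v,l,r)$: $insert(x,b,t)\equiv cons(k,v,insert(x,b,l),r)$ if $x<k$; $insert(x,b,t)\equiv cons(k,v,l,insert(x,b,r))$ if $x>k$; $insert(x,b,t)\equiv cons(k,b,l,r)$ if $x=k$. The function $search$ is defined recursively by: - $search(x,e)\equiv default$; - if $t\equiv cons(k,v,l,r)$: $search(x,t)\equiv search(x,l)$ if $x<k$; $search(x,t)\equiv search(x,r)$ if $x>k$;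 $search(x,t)\equiv v$ if $x=k$. *)

theory Defs
  imports Main
begin

(* The W-type of binary trees is rendered as the datatype with the same constructors
   (a leaf, and a binary node for each key-value pair). No ordering invariant is imposed. *)
datatype ('k, 'v) bt = Empty | Cons 'k 'v "('k, 'v) bt" "('k, 'v) bt"

primrec bt_insert :: "'k::linorder \<Rightarrow> 'v \<Rightarrow> ('k, 'v) bt \<Rightarrow> ('k, 'v) bt" where
  "bt_insert x b Empty = Cons x b Empty Empty"
| "bt_insert x b (Cons k v l r) =
     (if x < k then Cons k v (bt_insert x b l) r
      else if x > k then Cons k v l (bt_insert x b r)
      else Cons k b l r)"

(* The first argument is the distinguished value returned on unsuccessful search; it is a
   parameter, so that it may be any element of the value type. *)
primrec bt_search :: "'v \<Rightarrow> 'k::linorder \<Rightarrow> ('k, 'v) bt \<Rightarrow> 'v" where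
  "bt_search dflt x Empty = dflt"
| "bt_search dflt x (Cons k v l r) =
     (if x < k then bt_search dflt x l
      else if x > k then bt_search dflt x r
      else v)"

end

theory Submission
  imports Defs
begin

text \<open>Insertion never changes the key of an existing node, so a search for \<open>x\<close> in
  the new tree makes the same comparisons, and takes the same branches, as the insertion did. Both
  descend into the same subtree, where the induction hypothesis applies, until they reach a node
  with key \<open>x\<close> that now carries \<open>b\<close>: either an old one overwritten or a
  new one replacing a leaf.\<close>

theorem proposition11:
  fixes dflt :: 'v and x :: "'k::linorder" and b :: 'v and t :: "('k, 'v) bt"
  shows "bt_search dflt x (bt_insert x b t) = b"
  by (induction t) auto

end
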